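(* Let $n\ge1$. The (normalized) Bergman metrics on $D^{III}_n$ and $\mathscr{S}_n$ are respectively given by \[ g_Z^{D^{III}_n}(U,V)=\mathrm{tr}\big((I_n-Z\overline{Z})^{-1}U(I_n-\overline{Z}Z)^{-1}\overline{V}\big),\qquad g_Z^{\mathscr{S}_n}(U,V)=\mathrm{tr}\big(\mathrm{Im}(Z)^{-1}U\,\mathrm{Im}(Z)^{-1}\overline{V}\big), \] for every $U,V\in\mathrm{Symm}(n,\mathbb{C})$ (and $Z$ in the corresponding domain). In particular, the K\"ahler forms of $D^{III}_n$ and $\mathscr{S}_n$ are respectively given by \[ \omega_Z^{D^{III}_n}(U,V)= i\,\mathrm{tr}\big((I_n-Z\overline{Z})^{-1}U(I_n-\overline{Z}Z)^{-1}\overline{V}\big)-i\,\mathrm{tr}\big((I_n-\overline{Z}Z)^{-1}\overline{U}(I_n-Z\overline{Z})^{-1}V\big), \] \[ \omega_Z^{\mathscr{S}_n}(U,V)=2\,\mathrm{tr}\big(\mathrm{Im}(Z)^{-1}\mathrm{Re}(U)\mathrm{Im}(Z)^{-1}\mathrm{Im}(V)\big)-2\,\mathrm{tr}\big(\mathrm{Im}(Z)^{-1}\mathrm{Im}(U)\mathrm{Im}(Z)^{-1}\mathrm{Re}(V)\big), \] for every $U,V\in\mathrm{Symm}(n,\mathbb{C})$.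
   Context: $D^{III}_n=\{Z\in\mathrm{Symm}(n,\mathbb{C}) : I_n-Z\overline{Z}>0\}$ and $\mathscr{S}_n=\{Z\in\mathrm{Symm}(n,\mathbb{C}) : \mathrm{Im}(Z)>0\}$, where $\mathrm{Symm}(n,\mathbb{C})$ is the space of symmetric complex $n\times n$ matrices with complex linear coordinates $z_{jk}$, $1\le j\le k\le n$ (the entries of $Z$); real and imaginary parts are entrywise. The Bergman kernels are $K_{D^{III}_n}(Z,W)=\det(I_n-Z\overline{W})^{-(n+1)}$ and $K_{\mathscr{S}_n}(Z,W)=\det(-i(Z-\overline{W}))^{-(n+1)}$. For $D$ either domain, the Bergman metric of $D$ is the field of Hermitian forms \[ g^D=c_D\sum_{1\le l\le m\le n,\;1\le j\le k\le n}\frac{\partial^2\log K_D(Z,Z)}{\partial z_{lm}\,\partial\overline{z}_{jk}}\,dz_{lm}\otimes d\overline{z}_{jk},\qquad c_{D^{III}_n}=\tfrac{1}{n+1},\quad c_{\mathscr{S}_n}=\tfrac{4}{n+1}, \] (Wirtinger derivatives), i.e. $g^D_Z(U,V)=c_D\sum\frac{\partial^2\log K_D(Z,Z)}{\partial z_{lm}\partial\overline{z}_{jk}}u_{lm}\overline{v_{jk}}$ for tangent vectors $U=(u_{lm}),V=(v_{jk})\in\mathrm{Symm}(n,\mathbb{C})$. The K\"ahler form is $\omega^D=-2\,\mathrm{Im}(g^D)$. *)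

theory Defs
  imports "HOL-Analysis.Analysis"
begin

text \<open>The size \<open>n \<ge> 1\<close> of the matrices is \<open>CARD('n)\<close>, for a finite index type \<open>'n\<close>.\<close>

type_synonym 'n cmat = "complex^'n^'n"
type_synonym 'n rmat = "real^'n^'n"

definition Symm :: "(('n::finite) cmat) set" where
  "Symm = {Z. transpose Z = Z}"

abbreviation conj_mat :: "('n::finite) cmat \<Rightarrow> 'n cmat" where
  "conj_mat \<equiv> map_matrix cnj"

abbreviation Re_mat :: "('n::finite) cmat \<Rightarrow> 'n rmat" where
  "Re_mat \<equiv> map_matrix Re"

abbreviation Im_mat :: "('n::finite) cmat \<Rightarrow> 'n rmat" where
  "Im_mat \<equiv> map_matrix Im"

abbreviation cplx_mat :: "('n::finite) rmat \<Rightarrow> 'n cmat" where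
  "cplx_mat \<equiv> map_matrix complex_of_real"

definition herm_pos_def :: "('n::finite) cmat \<Rightarrow> bool" where
  "herm_pos_def A \<longleftrightarrow>
     transpose (conj_mat A) = A \<and>
     (\<forall>v. v \<noteq> 0 \<longrightarrow> Re (\<Sum>i\<in>UNIV. cnj (v $ i) * (A *v v) $ i) > 0)"

definition sym_pos_def :: "('n::finite) rmat \<Rightarrow> bool" where
  "sym_pos_def A \<longleftrightarrow> transpose A = A \<and> (\<forall>v. v \<noteq> 0 \<longrightarrow> v \<bullet> (A *v v) > 0)"

definition domain_DIII :: "(('n::finite) cmat) set" where
  "domain_DIII = {Z \<in> Symm. herm_pos_def (mat 1 - Z ** conj_mat Z)}"

definition siegel_space :: "(('n::finite) cmat) set" where
  "siegel_space = {Z \<in> Symm. sym_pos_def (Im_mat Z)}"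

definition bergman_kernel_DIII :: "('n::finite) cmat \<Rightarrow> 'n cmat \<Rightarrow> complex" where
  "bergman_kernel_DIII Z W =
     det (mat 1 - Z ** conj_mat W) powi (- (int CARD('n) + 1))"

definition bergman_kernel_siegel :: "('n::finite) cmat \<Rightarrow> 'n cmat \<Rightarrow> complex" where
  "bergman_kernel_siegel Z W =
     det (map_matrix (\<lambda>w. - \<i> * w) (Z - conj_mat W)) powi (- (int CARD('n) + 1))"

text \<open>
  The symmetric matrix whose coordinate \<open>z\<^bsub>lm\<^esub>\<close> is \<open>c\<close> and whose other coordinates
  vanish. For \<open>l \<noteq> m\<close> it has two nonzero entries, because the coordinates of the space of
  symmetric matrices are the entries on and above the diagonal.
\<close>

definition sym_coord :: "('n::finite) \<Rightarrow> 'n \<Rightarrow> complex \<Rightarrow> 'n cmat" where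
  "sym_coord l m c = (\<chi> i j. if i = l \<and> j = m \<or> i = m \<and> j = l then c else 0)"

text \<open>
  Partial derivatives with respect to the real coordinates \<open>x\<^bsub>lm\<^esub>\<close>, \<open>y\<^bsub>lm\<^esub>\<close>, where
  \<open>z\<^bsub>lm\<^esub> = x\<^bsub>lm\<^esub> + \<i> y\<^bsub>lm\<^esub>\<close>, and the Wirtinger derivatives with respect to
  \<open>z\<^bsub>lm\<^esub>\<close> and its conjugate. At a symmetric \<open>Z\<close> they only involve values of \<open>f\<close> on
  symmetric matrices.
\<close>

definition partial_x ::
    "('n::finite) \<Rightarrow> 'n \<Rightarrow> ('n cmat \<Rightarrow> complex) \<Rightarrow> 'n cmat \<Rightarrow> complex" where
  "partial_x l m f Z =
     vector_derivative (\<lambda>t::real. f (Z + sym_coord l m (of_real t))) (at 0)"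

definition partial_y ::
    "('n::finite) \<Rightarrow> 'n \<Rightarrow> ('n cmat \<Rightarrow> complex) \<Rightarrow> 'n cmat \<Rightarrow> complex" where
  "partial_y l m f Z =
     vector_derivative (\<lambda>t::real. f (Z + sym_coord l m (\<i> * of_real t))) (at 0)"

definition wirtinger ::
    "('n::finite) \<Rightarrow> 'n \<Rightarrow> ('n cmat \<Rightarrow> complex) \<Rightarrow> 'n cmat \<Rightarrow> complex" where
  "wirtinger l m f Z = (partial_x l m f Z - \<i> * partial_y l m f Z) / 2"

definition wirtinger_bar ::
    "('n::finite) \<Rightarrow> 'n \<Rightarrow> ('n cmat \<Rightarrow> complex) \<Rightarrow> 'n cmat \<Rightarrow> complex" where
  "wirtinger_bar l m f Z = (partial_x l m f Z + \<i> * partial_y l m f Z) / 2"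

text \<open>
  The field of Hermitian forms with potential \<open>log K(Z,Z)\<close>, scaled by \<open>c\<close>. On either
  domain \<open>K(Z,Z)\<close> is a positive real number, so \<^const>\<open>Ln\<close> is the real logarithm there.
  The linear order on \<open>'n\<close> plays the role of the order of \<open>1, \<dots>, n\<close> and only serves to select
  the coordinates \<open>z\<^bsub>lm\<^esub>\<close> with \<open>l \<le> m\<close>.
\<close>

definition bergman_metric ::
    "complex \<Rightarrow> (('n::{finite,linorder}) cmat \<Rightarrow> 'n cmat \<Rightarrow> complex) \<Rightarrow>
     'n cmat \<Rightarrow> 'n cmat \<Rightarrow> 'n cmat \<Rightarrow> complex" where
  "bergman_metric c K Z U V =
     c * (\<Sum>(l, m) \<in> {(l, m). l \<le> m}. \<Sum>(j, k) \<in> {(j, k). j \<le> k}.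
            wirtinger l m (wirtinger_bar j k (\<lambda>W. Ln (K W W))) Z * U $ l $ m * cnj (V $ j $ k))"

definition metric_DIII ::
    "('n::{finite,linorder}) cmat \<Rightarrow> 'n cmat \<Rightarrow> 'n cmat \<Rightarrow> complex" where
  "metric_DIII = bergman_metric (1 / (of_nat CARD('n) + 1)) bergman_kernel_DIII"

definition metric_siegel ::
    "('n::{finite,linorder}) cmat \<Rightarrow> 'n cmat \<Rightarrow> 'n cmat \<Rightarrow> complex" where
  "metric_siegel = bergman_metric (4 / (of_nat CARD('n) + 1)) bergman_kernel_siegel"

definition kaehler_form ::
    "(('n::finite) cmat \<Rightarrow> 'n cmat \<Rightarrow> 'n cmat \<Rightarrow> complex) \<Rightarrow>
     'n cmat \<Rightarrow> 'n cmat \<Rightarrow> 'n cmat \<Rightarrow> real" where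
  "kaehler_form g Z U V = - 2 * Im (g Z U V)"

end

theory Submission
  imports Defs
begin

text \<open>
  Both kernels have the form \<open>K(W,W) = det (M W)\<^sup>k\<close> with \<open>k = - (n + 1)\<close>, where
  \<open>dM\<^sub>W(H) = H B(W) + A(W) conj H\<close> and \<open>A\<close> is complex affine with \<open>dA(H) = a H\<close>:
  \<open>M = 1 - W conj W\<close>, \<open>B = - conj W\<close>, \<open>A = - W\<close>, \<open>a = -1\<close> for \<open>D\<^sup>I\<^sup>I\<^sup>I\<close>, and \<open>M = - \<i> (W - conj W)\<close>,
  \<open>B = - \<i>\<close>, \<open>A = \<i>\<close>, \<open>a = 0\<close> for the Siegel space. By Jacobi's formula the antiholomorphic
  derivative of \<open>log K\<close> in direction \<open>E\<close> is \<open>k tr (A E M\<^sup>-\<^sup>1)\<close>, and its holomorphic derivative in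
  direction \<open>F\<close> is \<open>- k tr (M\<^sup>-\<^sup>1 F (B M\<^sup>-\<^sup>1 A - a) E)\<close>. For \<open>D\<^sup>I\<^sup>I\<^sup>I\<close>
  \<open>B M\<^sup>-\<^sup>1 A - a = 1 + conj W (1 - W conj W)\<^sup>-\<^sup>1 W = (1 - conj W W)\<^sup>-\<^sup>1\<close>; for the Siegel space it is
  \<open>M\<^sup>-\<^sup>1 = (2 Im W)\<^sup>-\<^sup>1\<close>.
\<close>

section \<open>Matrix product, trace and conjugation as bounded (bi)linear maps\<close>

lemma bilinear_matrix_mult:
  "bilinear ((**) :: complex^'n^'m \<Rightarrow> complex^'p^'n \<Rightarrow> complex^'p^'m)"
  by (auto intro!: linearI
      simp: bilinear_def matrix_matrix_mult_def vec_eq_iff sum.distrib algebra_simps scaleR_sum_right)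

interpretation matrix_mult: bounded_bilinear
  "(**) :: complex^'n^'m \<Rightarrow> complex^'p^'n \<Rightarrow> complex^'p^'m"
  using bilinear_matrix_mult by (simp add: bilinear_conv_bounded_bilinear)

lemma bounded_linear_trace: "bounded_linear (trace :: complex^'n^'n \<Rightarrow> complex)"
  by (auto intro!: linearI simp: linear_conv_bounded_linear[symmetric] trace_def sum.distrib scaleR_sum_right)

lemmas trace_scaleR = linear_scale[OF bounded_linear.linear[OF bounded_linear_trace]]
lemmas trace_minus = linear_neg[OF bounded_linear.linear[OF bounded_linear_trace]]
lemmas trace_sum = linear_sum[OF bounded_linear.linear[OF bounded_linear_trace]]

lemma bounded_linear_conj_mat: "bounded_linear (conj_mat :: complex^'n^'n \<Rightarrow> complex^'n^'n)"
  by (auto intro!: linearI simp: linear_conv_bounded_linear[symmetric] vec_eq_iff)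

section \<open>Algebra and continuity of the matrix inverse\<close>

lemma matrix_inv_right_left:
  fixes A :: "'a::field^'n^'n"
  assumes "det A \<noteq> 0"
  shows "A ** matrix_inv A = mat 1" "matrix_inv A ** A = mat 1"
proof -
  from assms obtain B where "A ** B = mat 1 \<and> B ** A = mat 1"
    by (auto simp: invertible_det_nz[symmetric] invertible_def)
  then have "A ** matrix_inv A = mat 1 \<and> matrix_inv A ** A = mat 1"
    unfolding matrix_inv_def by (rule someI)
  then show "A ** matrix_inv A = mat 1" "matrix_inv A ** A = mat 1" by auto
qed

lemma matrix_inv_eqI:
  fixes A :: "'a::field^'n^'n"
  assumes "A ** B = mat 1"
  shows "matrix_inv A = B"
proof -
  have "det A \<noteq> 0"
    using assms by (auto simp: invertible_det_nz[symmetric] invertible_right_inverse)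
  then have "matrix_inv A ** (A ** B) = B"
    by (simp add: matrix_mul_assoc matrix_inv_right_left)
  with assms show ?thesis by simp
qed

text \<open>Cramer's rule for the system whose right-hand side is the unit vector
  \<open>axis j 1\<close>. It writes each entry of the inverse as a quotient of determinants, which
  yields continuity of the inverse.\<close>

lemma matrix_inv_component:
  fixes A :: "'a::field^'n^'n"
  assumes "det A \<noteq> 0"
  shows "matrix_inv A $ i $ j =
    det (\<chi> r c. if c = i then (axis j 1 :: 'a^'n) $ r else A $ r $ c) / det A"
proof -
  have "A *v (matrix_inv A *v axis j 1) = axis j 1"
    using assms by (simp add: matrix_vector_mul_assoc matrix_inv_right_left)
  then have "matrix_inv A *v axis j 1 =
      (\<chi> i. det (\<chi> r c. if c = i then (axis j 1 :: 'a^'n) $ r else A $ r $ c) / det A)"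
    using cramer[OF assms] by blast
  moreover have "(matrix_inv A *v axis j 1) $ i = matrix_inv A $ i $ j"
    by (simp add: matrix_vector_mult_def axis_def if_distrib cong: if_cong)
  ultimately show ?thesis by simp
qed

lemma tendsto_det:
  fixes X :: "'b \<Rightarrow> 'a::real_normed_field^'n^'n"
  assumes "(X \<longlongrightarrow> A) F"
  shows "((\<lambda>x. det (X x)) \<longlongrightarrow> det A) F"
  unfolding det_def using assms by (intro tendsto_intros)

lemma tendsto_matrix_inv:
  fixes X :: "'b \<Rightarrow> complex^'n^'n"
  assumes X: "(X \<longlongrightarrow> A) F" and A: "det A \<noteq> 0"
  shows "((\<lambda>x. matrix_inv (X x)) \<longlongrightarrow> matrix_inv A) F"
proof (intro vec_tendstoI)
  fix i j
  let ?R = "\<lambda>A. (\<chi> r c. if c = i then (axis j 1 :: complex^'n) $ r else A $ r $ c) :: complex^'n^'n"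
  have "((\<lambda>x. ?R (X x)) \<longlongrightarrow> ?R A) F"
  proof (intro tendsto_vec_lambda)
    fix r c
    show "((\<lambda>x. if c = i then (axis j 1 :: complex^'n) $ r else X x $ r $ c) \<longlongrightarrow>
        (if c = i then axis j 1 $ r else A $ r $ c)) F"
      using X by (cases "c = i") (auto intro!: tendsto_intros)
  qed
  then have "((\<lambda>x. det (?R (X x)) / det (X x)) \<longlongrightarrow> det (?R A) / det A) F"
    using X A by (intro tendsto_divide tendsto_det)
  then have "((\<lambda>x. det (?R (X x)) / det (X x)) \<longlongrightarrow> matrix_inv A $ i $ j) F"
    using matrix_inv_component[OF A, of i j] by simp
  moreover have "\<forall>\<^sub>F x in F. det (X x) \<noteq> 0"
    using tendsto_det[OF X] A by (rule tendsto_imp_eventually_ne)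
  then have "\<forall>\<^sub>F x in F. det (?R (X x)) / det (X x) = matrix_inv (X x) $ i $ j"
    by eventually_elim (simp add: matrix_inv_component)
  ultimately show "((\<lambda>x. matrix_inv (X x) $ i $ j) \<longlongrightarrow> matrix_inv A $ i $ j) F"
    by (rule Lim_transform_eventually)
qed

section \<open>Derivatives of the inverse and of the determinant along a curve\<close>

lemma has_vector_derivative_iff_quotient:
  fixes f :: "real \<Rightarrow> 'a::real_normed_vector"
  shows "(f has_vector_derivative D) (at x) \<longleftrightarrow> ((\<lambda>y. (f y - f x) /\<^sub>R (y - x)) \<longlongrightarrow> D) (at x)"
proof -
  have "norm (f y - f x - (y - x) *\<^sub>R D) / norm (y - x) = norm ((f y - f x) /\<^sub>R (y - x) - D)"
    if "y \<noteq> x" for y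
  proof -
    have "(f y - f x) /\<^sub>R (y - x) - D = (f y - f x - (y - x) *\<^sub>R D) /\<^sub>R (y - x)"
      using that by (simp add: scaleR_diff_right)
    then show ?thesis by (simp add: divide_inverse_commute abs_inverse)
  qed
  then have "((\<lambda>y. norm (f y - f x - (y - x) *\<^sub>R D) / norm (y - x)) \<longlongrightarrow> 0) (at x) \<longleftrightarrow>
      ((\<lambda>y. norm ((f y - f x) /\<^sub>R (y - x) - D)) \<longlongrightarrow> 0) (at x)"
    by (intro filterlim_cong) (auto simp: eventually_at_filter)
  then show ?thesis
    by (simp add: has_vector_derivative_def has_derivative_iff_norm bounded_linear_scaleR_left
        tendsto_norm_zero_iff LIM_zero_iff)
qed

text \<open>By the resolvent identity, the difference of the inverses at \<open>s\<close> and
  \<open>t\<close> is minus the inverse at \<open>s\<close> times \<open>X s - X t\<close> times the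
  inverse at \<open>t\<close>. After division by \<open>s - t\<close>, continuity of the inverse
  suffices to pass to the limit.\<close>

lemma has_vector_derivative_matrix_inv:
  fixes X :: "real \<Rightarrow> complex^'n^'n"
  assumes X: "(X has_vector_derivative X') (at t)" and det: "det (X t) \<noteq> 0"
  shows "((\<lambda>s. matrix_inv (X s)) has_vector_derivative
           - (matrix_inv (X t) ** X' ** matrix_inv (X t))) (at t)"
proof -
  let ?I = "\<lambda>s. matrix_inv (X s)"
  have lim: "(X \<longlongrightarrow> X t) (at t)"
    using has_vector_derivative_continuous[OF X] by (simp add: isCont_def)
  have "((\<lambda>s. - (?I s ** ((X s - X t) /\<^sub>R (s - t)) ** ?I t)) \<longlongrightarrow> - (?I t ** X' ** ?I t)) (at t)"
    using X[unfolded has_vector_derivative_iff_quotient] tendsto_matrix_inv[OF lim det]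
    by (intro tendsto_minus matrix_mult.tendsto tendsto_const)
  moreover have "\<forall>\<^sub>F s in at t. det (X s) \<noteq> 0"
    using tendsto_det[OF lim] det by (rule tendsto_imp_eventually_ne)
  then have "\<forall>\<^sub>F s in at t. - (?I s ** ((X s - X t) /\<^sub>R (s - t)) ** ?I t) = (?I s - ?I t) /\<^sub>R (s - t)"
  proof eventually_elim
    case (elim s)
    have "?I s ** (X s - X t) ** ?I t = ?I t - ?I s ** (X t ** ?I t)"
      using elim by (simp add: matrix_mult.diff_left matrix_mult.diff_right matrix_inv_right_left
          flip: matrix_mul_assoc)
    then show ?case
      by (simp add: matrix_mult.scaleR_left matrix_mult.scaleR_right matrix_inv_right_left det
          flip: scaleR_minus_right)
  qed
  ultimately show ?thesis
    unfolding has_vector_derivative_iff_quotient by (rule Lim_transform_eventually)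
qed

text \<open>
  Jacobi's formula: writing \<open>X' = C X\<close>, the determinant of \<open>X\<close> with row \<open>i\<close> replaced by row \<open>i\<close>
  of \<open>X'\<close> is \<open>C\<^sub>i\<^sub>i det X\<close>.
\<close>

lemma has_vector_derivative_det:
  fixes X :: "real \<Rightarrow> complex^'n^'n"
  assumes X: "(X has_vector_derivative X') (at t)" and det: "det (X t) \<noteq> 0"
  shows "((\<lambda>s. det (X s)) has_vector_derivative
           det (X t) * trace (X' ** matrix_inv (X t))) (at t)"
proof -
  let ?C = "X' ** matrix_inv (X t)"
  have comp: "((\<lambda>s. X s $ i $ j) has_derivative (\<lambda>h. h *\<^sub>R X' $ i $ j)) (at t)" for i j
  proof -
    have "((\<lambda>s. X s $ i $ j) has_vector_derivative X' $ i $ j) (at t)"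
      using X by (intro bounded_linear.has_vector_derivative[OF bounded_linear_vec_nth])
    then show ?thesis by (simp add: has_vector_derivative_def)
  qed
  have row: "(\<Sum>p | p permutes UNIV. of_int (sign p) * (X' $ i $ p i * (\<Prod>j\<in>UNIV - {i}. X t $ j $ p j))) =
      ?C $ i $ i * det (X t)" for i
  proof -
    have "X' = ?C ** X t"
      using det by (simp add: matrix_inv_right_left flip: matrix_mul_assoc)
    then have "X' $ i = (?C ** X t) $ i" by (rule arg_cong)
    also have "\<dots> = (\<Sum>k\<in>UNIV. ?C $ i $ k *s row k (X t))"
      by (subst matrix_matrix_mult_def) (simp add: vec_eq_iff row_def)
    finally have X'_row: "X' $ i = (\<Sum>k\<in>UNIV. ?C $ i $ k *s row k (X t))" .
    have "det (\<chi> r. if r = i then X' $ i else row r (X t)) = ?C $ i $ i * det (X t)"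
      using cramer_lemma_transpose[of i "?C $ i" "X t"] unfolding X'_row .
    moreover have "(\<Prod>r\<in>UNIV. (if r = i then X' $ i else row r (X t)) $ p r) =
        X' $ i $ p i * (\<Prod>j\<in>UNIV - {i}. X t $ j $ p j)" for p
      by (subst prod.remove[of _ i]) (auto simp: row_def intro!: prod.cong)
    ultimately show ?thesis by (simp add: det_def)
  qed
  \<comment> \<open>The product rule in each term of the Leibniz expansion; exchanging the two sums
    then groups the terms by the differentiated row \<open>i\<close>, as in
    \<open>row\<close>.\<close>
  have "((\<lambda>s. det (X s)) has_derivative
      (\<lambda>h. \<Sum>p | p permutes UNIV. of_int (sign p) *
         (\<Sum>i\<in>UNIV. (h *\<^sub>R X' $ i $ p i) * (\<Prod>j\<in>UNIV - {i}. X t $ j $ p j)))) (at t)"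
    unfolding det_def by (intro has_derivative_sum has_derivative_mult_right has_derivative_prod comp)
  also have "(\<lambda>h. \<Sum>p | p permutes UNIV. of_int (sign p) *
         (\<Sum>i\<in>UNIV. (h *\<^sub>R X' $ i $ p i) * (\<Prod>j\<in>UNIV - {i}. X t $ j $ p j))) =
      (\<lambda>h. h *\<^sub>R (\<Sum>i\<in>UNIV. \<Sum>p | p permutes UNIV. of_int (sign p) *
         (X' $ i $ p i * (\<Prod>j\<in>UNIV - {i}. X t $ j $ p j))))"
    by (subst sum.swap) (simp add: sum_distrib_left scaleR_sum_right)
  finally show ?thesis
    by (simp add: has_vector_derivative_def row trace_def sum_distrib_left mult.commute)
qed

section \<open>Entrywise complex conjugation\<close>

lemma conj_mat_mult: "conj_mat (A ** B) = conj_mat A ** conj_mat B"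
  by (simp add: vec_eq_iff matrix_matrix_mult_def)

lemma conj_mat_conj_mat [simp]: "conj_mat (conj_mat A) = A"
  by (simp add: vec_eq_iff)

lemma conj_mat_mat [simp]: "conj_mat (mat c) = mat (cnj c)"
  by (simp add: vec_eq_iff mat_def)

lemma conj_mat_diff: "conj_mat (A - B) = conj_mat A - conj_mat B"
  by (simp add: vec_eq_iff)

lemma det_conj_mat: "det (conj_mat A) = cnj (det A)"
  by (simp add: det_def)

lemma trace_conj_mat: "trace (conj_mat A) = cnj (trace A)"
  by (simp add: trace_def)

lemma matrix_inv_conj_mat:
  assumes "det A \<noteq> 0"
  shows "matrix_inv (conj_mat A) = conj_mat (matrix_inv A)"
  using assms by (intro matrix_inv_eqI) (simp add: matrix_inv_right_left flip: conj_mat_mult)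

section \<open>Determinants of positive definite Hermitian matrices\<close>

lemma herm_pos_def_scaleR:
  assumes "herm_pos_def A" and "0 < r"
  shows "herm_pos_def (r *\<^sub>R A)"
proof -
  have "transpose (conj_mat (r *\<^sub>R A)) = r *\<^sub>R transpose (conj_mat A)"
    by (simp add: vec_eq_iff transpose_def)
  moreover have "(\<Sum>i\<in>UNIV. cnj (v $ i) * ((r *\<^sub>R A) *v v) $ i) =
      r *\<^sub>R (\<Sum>i\<in>UNIV. cnj (v $ i) * (A *v v) $ i)" for v
    by (simp add: matrix_vector_mult_def flip: scaleR_sum_right)
  ultimately show ?thesis
    using assms by (simp add: herm_pos_def_def)
qed

text \<open>A singular matrix has a nonzero kernel vector, on which the Hermitian form would
  vanish.\<close>

lemma herm_pos_def_det_nonzero: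
  assumes "herm_pos_def A"
  shows "det A \<noteq> 0"
proof
  assume "det A = 0"
  then have "\<not> (\<exists>B. B ** A = mat 1)"
    by (simp add: invertible_det_nz flip: invertible_left_inverse)
  then obtain v where "A *v v = 0" "v \<noteq> 0"
    by (auto simp: matrix_left_invertible_ker)
  with assms show False
    by (auto simp: herm_pos_def_def)
qed

lemma herm_pos_def_det_real:
  assumes "herm_pos_def A"
  shows "det A \<in> \<real>"
proof -
  have "cnj (det A) = det (transpose (conj_mat A))" by (simp add: det_conj_mat)
  also have "\<dots> = det A" using assms by (simp add: herm_pos_def_def)
  finally show ?thesis by (simp add: Reals_cnj_iff)
qed

lemma herm_pos_def_segment:
  fixes A :: "complex^'n^'n"
  assumes A: "herm_pos_def A" and t: "0 \<le> t" "t \<le> 1"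
  shows "herm_pos_def ((1 - t) *\<^sub>R mat 1 + t *\<^sub>R A)"
  unfolding herm_pos_def_def
proof (intro conjI allI impI)
  have "A $ i $ j = cnj (A $ j $ i)" for i j
  proof -
    have "transpose (conj_mat A) $ i $ j = A $ i $ j"
      using A by (simp add: herm_pos_def_def)
    then show ?thesis by (simp add: transpose_def)
  qed
  from this[symmetric]
  show "transpose (conj_mat ((1 - t) *\<^sub>R mat 1 + t *\<^sub>R A)) = (1 - t) *\<^sub>R mat 1 + t *\<^sub>R A"
    by (auto simp: vec_eq_iff transpose_def mat_def)
next
  fix v :: "complex^'n" assume "v \<noteq> 0"
  let ?q = "\<lambda>A. Re (\<Sum>i\<in>UNIV. cnj (v $ i) * (A *v v) $ i)"
  have 1: "0 < ?q A"
    using A \<open>v \<noteq> 0\<close> by (auto simp: herm_pos_def_def)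
  obtain k where "v $ k \<noteq> 0"
    using \<open>v \<noteq> 0\<close> by (auto simp: vec_eq_iff)
  have "?q (mat 1) = (\<Sum>i\<in>UNIV. (cmod (v $ i))\<^sup>2)"
    by (simp add: cmod_power2) (simp add: power2_eq_square)
  also have "\<dots> > 0"
    by (rule sum_pos2[of _ k]) (auto simp: \<open>v $ k \<noteq> 0\<close>)
  finally have 2: "0 < ?q (mat 1)" .
  have eq: "((1 - t) *\<^sub>R mat 1 + t *\<^sub>R A) *v v = (1 - t) *\<^sub>R (mat 1 *v v) + t *\<^sub>R (A *v v)"
    unfolding matrix_vector_mult_add_rdistrib
    by (simp add: matrix_vector_mult_def vec_eq_iff scaleR_sum_right)
  have "?q ((1 - t) *\<^sub>R mat 1 + t *\<^sub>R A) = (1 - t) * ?q (mat 1) + t * ?q A"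
    unfolding eq by (simp add: sum.distrib sum_subtractf sum_distrib_left algebra_simps)
  also have "\<dots> > 0"
  \<comment> \<open>For \<open>t > 0\<close> the summand of \<open>A\<close> is positive and the
    other one nonnegative; for \<open>t = 0\<close> only the positive summand of the identity
    remains.\<close>
  proof (cases "t = 0")
    case False
    then show ?thesis using t 1 2 by (intro add_nonneg_pos) auto
  qed (use 2 in simp)
  finally show "0 < ?q ((1 - t) *\<^sub>R mat 1 + t *\<^sub>R A)" .
qed

text \<open>Along the segment from the identity to \<open>A\<close> the determinant is real and never vanishes.\<close>

lemma herm_pos_def_det_pos:
  fixes A :: "complex^'n^'n"
  assumes A: "herm_pos_def A"
  shows "det A \<in> \<real>" "0 < Re (det A)"
proof -
  show "det A \<in> \<real>" using A by (rule herm_pos_def_det_real)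
  let ?P = "\<lambda>t. (1 - t) *\<^sub>R mat 1 + t *\<^sub>R A"
  have nz: "Re (det (?P t)) \<noteq> 0" if "0 \<le> t" "t \<le> 1" for t
    using herm_pos_def_det_nonzero[OF herm_pos_def_segment[OF A that]]
      herm_pos_def_det_real[OF herm_pos_def_segment[OF A that]]
    by (auto simp: complex_eq_iff complex_is_Real_iff)
  have cont: "continuous_on {0..1} (\<lambda>t. Re (det (?P t)))"
    unfolding continuous_on_def by (auto intro!: tendsto_intros tendsto_det)
  show "0 < Re (det A)"
  proof (rule ccontr)
    assume "\<not> 0 < Re (det A)"
    \<comment> \<open>The real part of the determinant is 1 at \<open>t = 0\<close> and would be
      nonpositive at \<open>t = 1\<close>.\<close>
    then have "\<exists>t. 0 \<le> t \<and> t \<le> 1 \<and> Re (det (?P t)) = 0"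
      by (intro IVT2' cont) auto
    with nz show False by blast
  qed
qed

section \<open>Coordinates of symmetric matrices and Wirtinger derivatives\<close>

text \<open>Complex homogeneity in the coordinate, with \<open>Q\<close> moved to the front by
  cyclicity of the trace. Directions \<open>\<i>\<close> and \<open>cnj \<i>\<close> thereby reduce
  to direction 1, so that terms cancel or double in Wirtinger derivatives.\<close>

lemma trace_sym_coord: "trace (P ** sym_coord l m c ** Q) = c * trace (P ** sym_coord l m 1 ** Q)"
proof -
  have "trace (R ** sym_coord l m c) = c * trace (R ** sym_coord l m 1)" for R
    by (simp add: trace_def matrix_matrix_mult_def sym_coord_def sum_distrib_left if_distrib
        mult.commute cong: if_cong)
  from this[of "Q ** P"] show ?thesis
    by (metis trace_mul_sym matrix_mul_assoc)
qed

lemma sym_coord_scaleR: "sym_coord l m (t *\<^sub>R c) = t *\<^sub>R sym_coord l m c"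
  by (simp add: vec_eq_iff sym_coord_def)

lemma conj_mat_sym_coord: "conj_mat (sym_coord l m c) = sym_coord l m (cnj c)"
  by (simp add: vec_eq_iff sym_coord_def)

lemma
  assumes "\<And>H. ((\<lambda>t::real. f (Z + t *\<^sub>R H)) has_vector_derivative D H) (at 0)"
  shows wirtinger_eqI:
      "wirtinger l m f Z = (D (sym_coord l m 1) - \<i> * D (sym_coord l m \<i>)) / 2"
    and wirtinger_bar_eqI:
      "wirtinger_bar l m f Z = (D (sym_coord l m 1) + \<i> * D (sym_coord l m \<i>)) / 2"
proof -
  have "sym_coord l m (of_real t) = t *\<^sub>R sym_coord l m 1"
    and "sym_coord l m (\<i> * of_real t) = t *\<^sub>R sym_coord l m \<i>" for t
    unfolding sym_coord_scaleR[symmetric] by (simp_all add: scaleR_conv_of_real mult.commute)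
  then have "partial_x l m f Z = D (sym_coord l m 1)" and "partial_y l m f Z = D (sym_coord l m \<i>)"
    by (simp_all add: partial_x_def partial_y_def vector_derivative_at[OF assms])
  then show "wirtinger l m f Z = (D (sym_coord l m 1) - \<i> * D (sym_coord l m \<i>)) / 2"
    and "wirtinger_bar l m f Z = (D (sym_coord l m 1) + \<i> * D (sym_coord l m \<i>)) / 2"
    by (simp_all add: wirtinger_def wirtinger_bar_def)
qed

text \<open>Only the pair \<open>(min i j, max i j)\<close> contributes to the entry at
  \<open>i\<close>, \<open>j\<close>; symmetry covers entries below the diagonal.\<close>

lemma Symm_eq_sum_sym_coord:
  fixes U :: "('n::{finite,linorder}) cmat"
  assumes "U \<in> Symm"
  shows "U = (\<Sum>(l, m) \<in> {(l, m). l \<le> m}. sym_coord l m (U $ l $ m))"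
proof (intro iffD2[OF vec_eq_iff] allI)
  fix i j
  have "U $ i $ j = U $ j $ i"
  proof -
    have "transpose U $ i $ j = U $ i $ j" using assms by (simp add: Symm_def)
    then show ?thesis by (simp add: transpose_def)
  qed
  then have sym: "U $ min i j $ max i j = U $ i $ j"
    by (simp add: min_def max_def)
  have "(\<Sum>(l, m) \<in> {(l, m). l \<le> m}. sym_coord l m (U $ l $ m)) $ i $ j =
      (\<Sum>p \<in> {(l, m). l \<le> m}. if p = (min i j, max i j) then U $ fst p $ snd p else 0)"
    unfolding sum_component
  proof (intro sum.cong refl)
    fix p :: "'n \<times> 'n" assume "p \<in> {(l, m). l \<le> m}"
    then obtain l m where "p = (l, m)" "l \<le> m" by blast
    then show "(case p of (l, m) \<Rightarrow> sym_coord l m (U $ l $ m)) $ i $ j =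
        (if p = (min i j, max i j) then U $ fst p $ snd p else 0)"
      by (cases "i \<le> j") (auto simp: sym_coord_def min_def max_def)
  qed
  also have "\<dots> = U $ i $ j"
    using sym by (subst sum.delta) (auto simp: min_le_iff_disj le_max_iff_disj)
  finally show "U $ i $ j = (\<Sum>(l, m) \<in> {(l, m). l \<le> m}. sym_coord l m (U $ l $ m)) $ i $ j" ..
qed

text \<open>Turns a sum over the coordinates with \<open>l \<le> m\<close> into a trace of the whole
  matrix. No weights appear off the diagonal, since \<open>sym_coord\<close> already fills both
  mirrored entries.\<close>

lemma sum_trace_sym_coord:
  fixes U :: "('n::{finite,linorder}) cmat"
  assumes "U \<in> Symm"
  shows "(\<Sum>(l, m) \<in> {(l, m). l \<le> m}. U $ l $ m * trace (P ** sym_coord l m 1 ** Q)) =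
    trace (P ** U ** Q)"
proof -
  have "trace (P ** U ** Q) =
      (\<Sum>(l, m) \<in> {(l, m). l \<le> m}. trace (P ** sym_coord l m (U $ l $ m) ** Q))"
    by (subst Symm_eq_sum_sym_coord[OF assms])
      (simp add: matrix_mult.sum_left matrix_mult.sum_right case_prod_beta trace_sum)
  also have "\<dots> = (\<Sum>(l, m) \<in> {(l, m). l \<le> m}. U $ l $ m * trace (P ** sym_coord l m 1 ** Q))"
    by (intro sum.cong refl) (auto intro: trace_sym_coord)
  finally show ?thesis ..
qed

lemma conj_mat_Symm: "V \<in> Symm \<Longrightarrow> conj_mat V \<in> Symm"
  by (auto simp: Symm_def transpose_def vec_eq_iff)

section \<open>Mixed second derivatives of the logarithm of a determinant power\<close>

text \<open>Jacobi's formula and the chain rule give the derivative along \<open>H\<close>, where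
  the factor \<open>det (M W)\<close> cancels. Its part from \<open>H ** B\<close> is complex linear
  and is annihilated by the antiholomorphic derivative; its part from \<open>conj_mat H\<close> is
  antilinear and survives.\<close>

lemma wirtinger_bar_Ln_det_power:
  fixes M :: "('n::finite) cmat \<Rightarrow> 'n cmat"
  assumes M: "\<And>H. ((\<lambda>t::real. M (W + t *\<^sub>R H)) has_vector_derivative H ** B + A ** conj_mat H) (at 0)"
    and det: "det (M W) \<noteq> 0" and Ln: "det (M W) powi k \<notin> \<real>\<^sub>\<le>\<^sub>0"
  shows "wirtinger_bar j k' (\<lambda>W. Ln (det (M W) powi k)) W =
    of_int k * trace (A ** sym_coord j k' 1 ** matrix_inv (M W))"
proof -
  let ?D = "\<lambda>H. of_int k * trace ((H ** B + A ** conj_mat H) ** matrix_inv (M W))"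
  have D: "((\<lambda>t::real. Ln (det (M (W + t *\<^sub>R H)) powi k)) has_vector_derivative ?D H) (at 0)" for H
  proof -
    have "((\<lambda>z. Ln (z powi k)) has_field_derivative of_int k / det (M W)) (at (det (M W)))"
      using det Ln
      by (auto intro!: derivative_eq_intros simp: power_int_diff field_simps)
    with has_vector_derivative_det[OF M, of H] det
    have "((\<lambda>z. Ln (z powi k)) \<circ> (\<lambda>t. det (M (W + t *\<^sub>R H))) has_vector_derivative
        det (M W) * trace ((H ** B + A ** conj_mat H) ** matrix_inv (M W)) *
          (of_int k / det (M W))) (at 0)"
      by (intro field_vector_diff_chain_at) simp_all
    then show ?thesis using det by (simp add: o_def mult.commute)
  qed
  have tr: "trace (sym_coord j k' c ** B ** matrix_inv (M W)) =
      c * trace (sym_coord j k' 1 ** B ** matrix_inv (M W))" for c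
    using trace_sym_coord[of "mat 1" j k' c "B ** matrix_inv (M W)"] by (simp add: matrix_mul_assoc)
  show ?thesis
    unfolding wirtinger_bar_eqI[OF D]
    by (simp add: matrix_mult.add_left trace_add conj_mat_sym_coord tr[of \<i>]
        trace_sym_coord[of A j k' "- \<i>"] algebra_simps)
qed

text \<open>Differentiates the outcome of the first derivative once more; \<open>E\<close> is the
  fixed first direction. The formula for \<open>f\<close> is required on a whole neighbourhood
  because \<open>f\<close> is differentiated. Now the complex linear terms in \<open>H\<close>
  survive and the antilinear one drops out.\<close>

lemma wirtinger_trace_inv:
  fixes M :: "('n::finite) cmat \<Rightarrow> 'n cmat"
  assumes M: "\<And>H. ((\<lambda>t::real. M (Z + t *\<^sub>R H)) has_vector_derivative H ** B + A Z ** conj_mat H) (at 0)"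
    and A: "\<And>H. ((\<lambda>t::real. A (Z + t *\<^sub>R H)) has_vector_derivative a *\<^sub>R H) (at 0)"
    and det: "det (M Z) \<noteq> 0"
    and f: "\<forall>\<^sub>F W in nhds Z. f W = c * trace (A W ** E ** matrix_inv (M W))"
  shows "wirtinger l m f Z =
    - c * trace (matrix_inv (M Z) ** sym_coord l m 1 **
            ((B ** matrix_inv (M Z) ** A Z - a *\<^sub>R mat 1) ** E))"
proof -
  let ?I = "matrix_inv (M Z)"
  let ?D = "\<lambda>H. c * trace (A Z ** E ** - (?I ** (H ** B + A Z ** conj_mat H) ** ?I) + a *\<^sub>R H ** E ** ?I)"
  have D: "((\<lambda>t::real. f (Z + t *\<^sub>R H)) has_vector_derivative ?D H) (at 0)" for H
  proof -
    have I: "((\<lambda>t::real. matrix_inv (M (Z + t *\<^sub>R H))) has_vector_derivative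
        - (?I ** (H ** B + A Z ** conj_mat H) ** ?I)) (at 0)"
      using has_vector_derivative_matrix_inv[OF M, of H] det by simp
    have AE: "((\<lambda>t. A (Z + t *\<^sub>R H) ** E) has_vector_derivative (a *\<^sub>R H) ** E) (at 0)"
      by (rule bounded_linear.has_vector_derivative[OF matrix_mult.bounded_linear_left A])
    have "((\<lambda>t. A (Z + t *\<^sub>R H) ** E ** matrix_inv (M (Z + t *\<^sub>R H))) has_vector_derivative
        A Z ** E ** - (?I ** (H ** B + A Z ** conj_mat H) ** ?I) + a *\<^sub>R H ** E ** ?I) (at 0)"
      using matrix_mult.has_vector_derivative[OF AE I] by simp
    then have "((\<lambda>t. c * trace (A (Z + t *\<^sub>R H) ** E ** matrix_inv (M (Z + t *\<^sub>R H))))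
        has_vector_derivative ?D H) (at 0)"
      by (intro has_vector_derivative_mult_right
          bounded_linear.has_vector_derivative[OF bounded_linear_trace])
    moreover have ev: "\<forall>\<^sub>F t::real in nhds 0. f (Z + t *\<^sub>R H) =
        c * trace (A (Z + t *\<^sub>R H) ** E ** matrix_inv (M (Z + t *\<^sub>R H)))"
    proof -
      \<comment> \<open>The neighbourhood of \<open>Z\<close> is pulled back along the real line in
        direction \<open>H\<close>.\<close>
      have "filterlim (\<lambda>t::real. Z + t *\<^sub>R H) (nhds (Z + 0 *\<^sub>R H)) (nhds 0)"
        by (intro tendsto_intros filterlim_ident)
      then show ?thesis using f by (auto dest: filterlim_iff[THEN iffD1])
    qed
    ultimately show ?thesis
      using eventually_nhds_x_imp_x[OF ev]
      by (subst has_vector_derivative_cong_ev) (auto elim: eventually_mono)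
  qed
  let ?F = "sym_coord l m"
  \<comment> \<open>Cyclicity brings every term to the form \<open>P ** H ** Q\<close> or
    \<open>P ** conj_mat H ** Q\<close> to which \<open>trace_sym_coord\<close> applies.\<close>
  have D_split: "?D H = c * (a * trace (?I ** H ** E)
      - trace (?I ** H ** (B ** ?I ** A Z ** E)) - trace ((?I ** A Z ** E ** ?I ** A Z) ** conj_mat H ** mat 1))"
    for H
  proof -
    have 1: "trace (H ** E ** ?I) = trace (?I ** H ** E)"
      using trace_mul_sym[of "H ** E" ?I] by (simp add: matrix_mul_assoc)
    have 2: "trace (A Z ** E ** (?I ** (H ** B) ** ?I)) = trace (?I ** H ** (B ** ?I ** A Z ** E))"
      using trace_mul_sym[of "A Z ** E" "?I ** H ** B ** ?I"] by (simp add: matrix_mul_assoc)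
    have 3: "trace (A Z ** E ** (?I ** (A Z ** conj_mat H) ** ?I)) =
        trace ((?I ** A Z ** E ** ?I ** A Z) ** conj_mat H ** mat 1)"
      using trace_mul_sym[of "A Z ** E ** ?I ** A Z ** conj_mat H" ?I] by (simp add: matrix_mul_assoc)
    show ?thesis
      by (simp only: matrix_mult.add_left matrix_mult.add_right matrix_mult.minus_right
          matrix_mult.scaleR_left trace_add trace_scaleR trace_minus 1 2 3)
        (simp add: scaleR_conv_of_real)
  qed
  show ?thesis
    unfolding wirtinger_eqI[OF D] D_split
    unfolding conj_mat_sym_coord
      trace_sym_coord[of _ _ _ \<i>] trace_sym_coord[of _ _ _ "cnj \<i>"]
    by (simp add: matrix_mult.diff_left matrix_mult.diff_right matrix_mult.scaleR_left
        matrix_mult.scaleR_right trace_sub trace_scaleR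
        scaleR_conv_of_real[where 'a = complex] field_simps)
qed

text \<open>The computation common to both domains: the antiholomorphic derivative is found near
  \<open>Z\<close>, the holomorphic one at \<open>Z\<close>, and the coordinate sums are then
  contracted to \<open>U\<close> and \<open>conj_mat V\<close>.\<close>

lemma bergman_metric_det_power:
  fixes M A B :: "('n::{finite,linorder}) cmat \<Rightarrow> 'n cmat"
  assumes K: "\<And>W. K W W = det (M W) powi k"
    and M: "\<And>W H. ((\<lambda>t::real. M (W + t *\<^sub>R H)) has_vector_derivative H ** B W + A W ** conj_mat H) (at 0)"
    and A: "\<And>H. ((\<lambda>t::real. A (Z + t *\<^sub>R H)) has_vector_derivative a *\<^sub>R H) (at 0)"
    and cont: "isCont M Z"
    and det: "det (M Z) \<in> \<real>" "0 < Re (det (M Z))"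
    and UV: "U \<in> Symm" "V \<in> Symm"
  shows "bergman_metric c K Z U V = - (c * of_int k) * trace (matrix_inv (M Z) ** U **
           (B Z ** matrix_inv (M Z) ** A Z - a *\<^sub>R mat 1) ** conj_mat V)"
proof -
  let ?I = "matrix_inv (M Z)" and ?N = "B Z ** matrix_inv (M Z) ** A Z - a *\<^sub>R mat 1"
  have nz: "det (M Z) \<noteq> 0" using det by auto
  have lim: "((\<lambda>W. det (M W)) \<longlongrightarrow> det (M Z)) (nhds Z)"
    using tendsto_det[OF cont[unfolded isCont_def]] by (simp add: tendsto_nhds_iff)
  have "det (M Z) powi k \<notin> \<real>\<^sub>\<le>\<^sub>0"
  proof -
    from det obtain r where "det (M Z) = of_real r" "0 < r"
      by (metis Re_complex_of_real Reals_cases)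
    then show ?thesis
      by (simp add: not_le zero_less_power_int flip: of_real_power_int)
  qed
  moreover have "((\<lambda>W. det (M W) powi k) \<longlongrightarrow> det (M Z) powi k) (nhds Z)"
    using lim nz by (intro tendsto_power_int)
  \<comment> \<open>That \<open>det (M W)\<close> is real and positive is assumed only at
    \<open>W = Z\<close>. Nearby it is enough that its power stays off the branch cut of
    \<open>Ln\<close>, which is closed.\<close>
  ultimately have "\<forall>\<^sub>F W in nhds Z. det (M W) powi k \<in> - \<real>\<^sub>\<le>\<^sub>0"
    by (intro topological_tendstoD) (auto simp: open_Compl closed_nonpos_Reals_complex)
  moreover have "\<forall>\<^sub>F W in nhds Z. det (M W) \<noteq> 0"
    using lim nz by (rule tendsto_imp_eventually_ne)
  ultimately have "\<forall>\<^sub>F W in nhds Z. wirtinger_bar j k' (\<lambda>W. Ln (K W W)) W =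
      of_int k * trace (A W ** sym_coord j k' 1 ** matrix_inv (M W))" for j k'
    unfolding K by eventually_elim (rule wirtinger_bar_Ln_det_power[OF M], auto)
  then have wirt: "wirtinger l m (wirtinger_bar j k' (\<lambda>W. Ln (K W W))) Z =
      - of_int k * trace (?I ** sym_coord l m 1 ** (?N ** sym_coord j k' 1))" for l m j k'
    by (rule wirtinger_trace_inv[OF M A nz])
  \<comment> \<open>The factors \<open>cnj (V $ j $ k')\<close> are the coordinates of the symmetric
    matrix \<open>conj_mat V\<close>.\<close>
  have inner: "(\<Sum>(j, k') \<in> {(j, k'). j \<le> k'}. u * trace (?I ** sym_coord l m 1 ** (?N ** sym_coord j k' 1))
        * cnj (V $ j $ k')) = u * trace (?I ** sym_coord l m 1 ** (?N ** conj_mat V))" for l m u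
    using sum_trace_sym_coord[OF conj_mat_Symm[OF UV(2)], of "?I ** sym_coord l m 1 ** ?N" "mat 1"]
    by (simp add: matrix_mul_assoc case_prod_beta sum_distrib_left mult_ac flip: sum_distrib_left)
  have "(\<Sum>(l, m) \<in> {(l, m). l \<le> m}. \<Sum>(j, k') \<in> {(j, k'). j \<le> k'}.
      wirtinger l m (wirtinger_bar j k' (\<lambda>W. Ln (K W W))) Z * U $ l $ m * cnj (V $ j $ k')) =
    (\<Sum>(l, m) \<in> {(l, m). l \<le> m}. - of_int k * U $ l $ m *
      trace (?I ** sym_coord l m 1 ** (?N ** conj_mat V)))"
    unfolding wirt inner[symmetric] by (simp add: mult_ac)
  also have "\<dots> = - of_int k * trace (?I ** U ** (?N ** conj_mat V))"
    unfolding sum_trace_sym_coord[OF UV(1), symmetric] sum_distrib_left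
    by (simp add: case_prod_beta mult.assoc)
  finally show ?thesis
    by (simp add: bergman_metric_def matrix_mul_assoc)
qed

section \<open>The metric of the bounded domain\<close>

lemma metric_DIII_eq:
  fixes Z U V :: "('n::{finite,linorder}) cmat"
  assumes Z: "Z \<in> domain_DIII" and UV: "U \<in> Symm" "V \<in> Symm"
  shows "metric_DIII Z U V = trace (matrix_inv (mat 1 - Z ** conj_mat Z) ** U **
           matrix_inv (mat 1 - conj_mat Z ** Z) ** conj_mat V)"
proof -
  let ?M = "\<lambda>Z :: 'n cmat. mat 1 - Z ** conj_mat Z" and ?k = "- (int CARD('n) + 1)"
  let ?I = "matrix_inv (?M Z)"
  have line: "((\<lambda>t::real. W + t *\<^sub>R H) has_vector_derivative H) (at 0)" for W H :: "'n cmat"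
    by (auto intro!: derivative_eq_intros)
  have M: "((\<lambda>t::real. ?M (W + t *\<^sub>R H)) has_vector_derivative
      H ** - conj_mat W + - W ** conj_mat H) (at 0)" for W H
    using has_vector_derivative_diff[OF has_vector_derivative_const
      matrix_mult.has_vector_derivative[OF line bounded_linear.has_vector_derivative
        [OF bounded_linear_conj_mat line]], of "mat 1" W H W H]
    by (simp add: matrix_mult.minus_left matrix_mult.minus_right minus_diff_commute)
  have A: "((\<lambda>t::real. - (Z + t *\<^sub>R H)) has_vector_derivative (- 1) *\<^sub>R H) (at 0)" for H
    using has_vector_derivative_minus[OF line] by simp
  have cont: "isCont ?M Z"
    by (intro continuous_intros matrix_mult.continuous bounded_linear.isCont[OF bounded_linear_conj_mat])
  have pd: "herm_pos_def (?M Z)"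
    using Z by (simp add: domain_DIII_def)
  have "metric_DIII Z U V = - (1 / (of_nat CARD('n) + 1) * of_int ?k) *
      trace (?I ** U ** (- conj_mat Z ** ?I ** - Z - (- 1) *\<^sub>R mat 1) ** conj_mat V)"
    unfolding metric_DIII_def
    by (rule bergman_metric_det_power[OF _ M A cont herm_pos_def_det_pos[OF pd] UV])
      (simp add: bergman_kernel_DIII_def)
  \<comment> \<open>The normalization cancels the exponent of the kernel, so the trace gets the
    factor \<open>- (- 1) = 1\<close>.\<close>
  also have "1 / (of_nat CARD('n) + 1) * of_int ?k = (- 1 :: complex)"
  proof -
    have "of_nat CARD('n) + 1 \<noteq> (0 :: complex)"
      using of_nat_neq_0[of "CARD('n)", where 'a = complex] by (simp add: add.commute)
    then show ?thesis by (simp add: field_simps)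
  qed
  also have "- conj_mat Z ** ?I ** - Z - (- 1) *\<^sub>R mat 1 = matrix_inv (mat 1 - conj_mat Z ** Z)"
  proof (rule matrix_inv_eqI[symmetric])
    \<comment> \<open>Pushing \<open>conj_mat Z\<close> through the difference makes
      \<open>mat 1 + conj_mat Z ** ?I ** Z\<close> a right inverse of
      \<open>mat 1 - conj_mat Z ** Z\<close>, which also proves the latter invertible.\<close>
    have "(mat 1 - conj_mat Z ** Z) ** conj_mat Z = conj_mat Z ** ?M Z"
      by (simp add: matrix_mult.diff_left matrix_mult.diff_right matrix_mul_assoc)
    then have "(mat 1 - conj_mat Z ** Z) ** conj_mat Z ** ?I = conj_mat Z"
      using herm_pos_def_det_nonzero[OF pd]
      by (simp add: matrix_inv_right_left flip: matrix_mul_assoc)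
    then have "(mat 1 - conj_mat Z ** Z) ** (conj_mat Z ** ?I ** Z) = conj_mat Z ** Z"
      by (simp add: matrix_mul_assoc)
    then show "(mat 1 - conj_mat Z ** Z) ** (- conj_mat Z ** ?I ** - Z - (- 1) *\<^sub>R mat 1) = mat 1"
      by (simp add: matrix_mult.minus_left matrix_mult.minus_right matrix_mult.add_right)
  qed
  finally show ?thesis by simp
qed

section \<open>The metric of the Siegel space\<close>

text \<open>With \<open>v\<close> split into real and imaginary parts, the real part of the
  Hermitian form is the sum of the values of the real form at the two parts, at least one of which
  is nonzero.\<close>

lemma herm_pos_def_cplx_mat:
  assumes "sym_pos_def Y"
  shows "herm_pos_def (cplx_mat Y)"
  unfolding herm_pos_def_def
proof (intro conjI allI impI)
  have "transpose Y = Y" using assms by (simp add: sym_pos_def_def)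
  then show "transpose (conj_mat (cplx_mat Y)) = cplx_mat Y"
    by (auto simp: vec_eq_iff transpose_def)
next
  fix v :: "complex^'a" assume "v \<noteq> 0"
  let ?x = "\<chi> i. Re (v $ i)" and ?y = "\<chi> i. Im (v $ i)"
  have pos: "0 < w \<bullet> (Y *v w)" if "w \<noteq> 0" for w
    using assms that by (simp add: sym_pos_def_def)
  then have nonneg: "0 \<le> w \<bullet> (Y *v w)" for w
    by (cases "w = 0") (auto intro: less_imp_le)
  have "?x \<noteq> 0 \<or> ?y \<noteq> 0"
    using \<open>v \<noteq> 0\<close> by (auto simp: vec_eq_iff complex_eq_iff)
  then have "0 < ?x \<bullet> (Y *v ?x) + ?y \<bullet> (Y *v ?y)"
    using pos nonneg by (auto intro: add_pos_nonneg add_nonneg_pos)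
  also have "\<dots> = Re (\<Sum>i\<in>UNIV. cnj (v $ i) * (cplx_mat Y *v v) $ i)"
    by (simp add: inner_vec_def matrix_vector_mult_def sum.distrib)
  finally show "0 < Re (\<Sum>i\<in>UNIV. cnj (v $ i) * (cplx_mat Y *v v) $ i)" .
qed

lemma cplx_mat_mult: "cplx_mat (A ** B) = cplx_mat A ** cplx_mat B"
  by (simp add: vec_eq_iff matrix_matrix_mult_def)

lemma cplx_mat_mat [simp]: "cplx_mat (mat c) = mat (of_real c)"
  by (simp add: vec_eq_iff mat_def)

lemma det_cplx_mat: "det (cplx_mat A) = of_real (det A)"
  by (simp add: det_def)

lemma sym_pos_def_det_nonzero: "sym_pos_def Y \<Longrightarrow> det Y \<noteq> 0"
  using herm_pos_def_det_nonzero[OF herm_pos_def_cplx_mat] by (simp add: det_cplx_mat)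

lemma metric_siegel_eq:
  fixes Z U V :: "('n::{finite,linorder}) cmat"
  assumes Z: "Z \<in> siegel_space" and UV: "U \<in> Symm" "V \<in> Symm"
  shows "metric_siegel Z U V = trace (cplx_mat (matrix_inv (Im_mat Z)) ** U **
           cplx_mat (matrix_inv (Im_mat Z)) ** conj_mat V)"
proof -
  let ?M = "\<lambda>Z :: 'n cmat. map_matrix (\<lambda>w. - \<i> * w) (Z - conj_mat Z)" and ?k = "- (int CARD('n) + 1)"
  let ?I = "matrix_inv (?M Z)" and ?J = "cplx_mat (matrix_inv (Im_mat Z))"
  \<comment> \<open>Scalar matrices bring \<open>?M\<close> into the shape with coefficients
    \<open>B\<close> and \<open>A\<close>, here both constant.\<close>
  have M_eq: "?M W = W ** mat (- \<i>) + mat \<i> ** conj_mat W" for W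
    by (simp add: vec_eq_iff matrix_matrix_mult_def mat_def if_distrib if_distribR algebra_simps
        cong: if_cong)
  have line: "((\<lambda>t::real. W + t *\<^sub>R H) has_vector_derivative H) (at 0)" for W H :: "'n cmat"
    by (auto intro!: derivative_eq_intros)
  have M: "((\<lambda>t::real. ?M (W + t *\<^sub>R H)) has_vector_derivative
      H ** mat (- \<i>) + mat \<i> ** conj_mat H) (at 0)" for W H
    unfolding M_eq
    by (intro has_vector_derivative_add line
        bounded_linear.has_vector_derivative[OF matrix_mult.bounded_linear_left]
        bounded_linear.has_vector_derivative[OF matrix_mult.bounded_linear_right]
        bounded_linear.has_vector_derivative[OF bounded_linear_conj_mat])
  have A: "((\<lambda>t::real. mat \<i> :: 'n cmat) has_vector_derivative 0 *\<^sub>R H) (at 0)" for H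
    by simp
  have cont: "isCont ?M Z"
    unfolding M_eq
    by (intro continuous_intros matrix_mult.continuous bounded_linear.isCont[OF bounded_linear_conj_mat])
  have Y: "sym_pos_def (Im_mat Z)" using Z by (simp add: siegel_space_def)
  have M_Im: "?M Z = 2 *\<^sub>R cplx_mat (Im_mat Z)"
    by (simp add: vec_eq_iff complex_eq_iff)
  have inv: "?I = (1 / 2) *\<^sub>R ?J"
    unfolding M_Im
    by (intro matrix_inv_eqI) (simp add: matrix_mult.scaleR_left matrix_mult.scaleR_right
        matrix_inv_right_left sym_pos_def_det_nonzero[OF Y] flip: cplx_mat_mult)
  have pd: "herm_pos_def (?M Z)"
    unfolding M_Im using herm_pos_def_cplx_mat[OF Y] by (rule herm_pos_def_scaleR) simp
  have "metric_siegel Z U V = - (4 / (of_nat CARD('n) + 1) * of_int ?k) *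
      trace (?I ** U ** (mat (- \<i>) ** ?I ** mat \<i> - 0 *\<^sub>R mat 1) ** conj_mat V)"
    unfolding metric_siegel_def
    by (rule bergman_metric_det_power[OF _ M A cont herm_pos_def_det_pos[OF pd] UV])
      (simp add: bergman_kernel_siegel_def)
  also have "4 / (of_nat CARD('n) + 1) * of_int ?k = (- 4 :: complex)"
  proof -
    have "of_nat CARD('n) + 1 \<noteq> (0 :: complex)"
      using of_nat_neq_0[of "CARD('n)", where 'a = complex] by (simp add: add.commute)
    then show ?thesis by (simp add: field_simps)
  qed
  also have "mat (- \<i>) ** ?I ** mat \<i> - 0 *\<^sub>R mat 1 = ?I"
    by (simp add: vec_eq_iff matrix_matrix_mult_def mat_def if_distrib if_distribR complex_eq_iff
        cong: if_cong)
  \<comment> \<open>Each of the two inverses of \<open>2 Im Z\<close> contributes a factor 1/2;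
    together they cancel the 4 left from the normalization.\<close>
  also have "?I ** U ** ?I ** conj_mat V = (1 / 4) *\<^sub>R (?J ** U ** ?J ** conj_mat V)"
    unfolding inv by (simp add: matrix_mult.scaleR_left matrix_mult.scaleR_right)
  finally show ?thesis by (simp add: trace_scaleR)
qed

theorem theorem3p10:
  fixes Z U V :: "('n::{finite,linorder}) cmat"
  assumes "U \<in> Symm" and "V \<in> Symm"
  shows
    "(Z \<in> domain_DIII \<longrightarrow>
        metric_DIII Z U V =
          trace (matrix_inv (mat 1 - Z ** conj_mat Z) ** U **
                 matrix_inv (mat 1 - conj_mat Z ** Z) ** conj_mat V) \<and>
        complex_of_real (kaehler_form metric_DIII Z U V) =
          \<i> * trace (matrix_inv (mat 1 - Z ** conj_mat Z) ** U **
                     matrix_inv (mat 1 - conj_mat Z ** Z) ** conj_mat V)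
          - \<i> * trace (matrix_inv (mat 1 - conj_mat Z ** Z) ** conj_mat U **
                       matrix_inv (mat 1 - Z ** conj_mat Z) ** V)) \<and>
     (Z \<in> siegel_space \<longrightarrow>
        metric_siegel Z U V =
          trace (cplx_mat (matrix_inv (Im_mat Z)) ** U **
                 cplx_mat (matrix_inv (Im_mat Z)) ** conj_mat V) \<and>
        kaehler_form metric_siegel Z U V =
          2 * trace (matrix_inv (Im_mat Z) ** Re_mat U ** matrix_inv (Im_mat Z) ** Im_mat V)
          - 2 * trace (matrix_inv (Im_mat Z) ** Im_mat U ** matrix_inv (Im_mat Z) ** Re_mat V))"
proof (intro conjI impI)
  assume Z: "Z \<in> domain_DIII"
  let ?M = "mat 1 - Z ** conj_mat Z" and ?N = "mat 1 - conj_mat Z ** Z"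
  let ?g = "trace (matrix_inv ?M ** U ** matrix_inv ?N ** conj_mat V)"
  show g: "metric_DIII Z U V = ?g"
    using Z assms by (rule metric_DIII_eq)
  have "det ?M \<noteq> 0"
    using Z by (intro herm_pos_def_det_nonzero) (simp add: domain_DIII_def)
  \<comment> \<open>Conjugation exchanges \<open>?M\<close> and \<open>?N\<close>, hence their
    inverses, which identifies \<open>cnj ?g\<close> with the second trace of the Kaehler
    form.\<close>
  then have inv_N: "matrix_inv ?N = conj_mat (matrix_inv ?M)"
    by (simp add: conj_mat_diff conj_mat_mult flip: matrix_inv_conj_mat)
  have "cnj ?g = trace (matrix_inv ?N ** conj_mat U ** matrix_inv ?M ** V)"
    by (simp add: inv_N conj_mat_mult flip: trace_conj_mat)
  moreover have "complex_of_real (- 2 * Im w) = \<i> * w - \<i> * cnj w" for w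
    by (simp add: complex_eq_iff)
  ultimately show "complex_of_real (kaehler_form metric_DIII Z U V) =
      \<i> * ?g - \<i> * trace (matrix_inv ?N ** conj_mat U ** matrix_inv ?M ** V)"
    by (simp only: kaehler_form_def g)
next
  assume Z: "Z \<in> siegel_space"
  let ?J = "matrix_inv (Im_mat Z)"
  show g: "metric_siegel Z U V = trace (cplx_mat ?J ** U ** cplx_mat ?J ** conj_mat V)"
    using Z assms by (rule metric_siegel_eq)
  \<comment> \<open>Multiplication by a real matrix commutes with taking real and imaginary parts,
    so these parts fall on \<open>U\<close> alone.\<close>
  have left: "Re_mat (cplx_mat X ** W) = X ** Re_mat W" "Im_mat (cplx_mat X ** W) = X ** Im_mat W"
    for X and W :: "'n cmat"
    by (simp_all add: vec_eq_iff matrix_matrix_mult_def)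
  have right: "Re_mat (W ** cplx_mat X) = Re_mat W ** X" "Im_mat (W ** cplx_mat X) = Im_mat W ** X"
    for X and W :: "'n cmat"
    by (simp_all add: vec_eq_iff matrix_matrix_mult_def)
  have "Im (trace (X ** conj_mat V)) = trace (Im_mat X ** Re_mat V) - trace (Re_mat X ** Im_mat V)" for X
    by (simp add: trace_def matrix_matrix_mult_def sum_subtractf)
  then show "kaehler_form metric_siegel Z U V =
      2 * trace (?J ** Re_mat U ** ?J ** Im_mat V) - 2 * trace (?J ** Im_mat U ** ?J ** Re_mat V)"
    by (simp add: kaehler_form_def g left right)
qed

end
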